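(* Let $(N,\mathbf{w},P,\mathbf{u})$ be a team formation model such that for all $x,x'\in X$ with $x'\neq x$ and $x'=x\cup\{p\}$ for some $p\in P$, and all $i\in n(p)$, one has $u_i(x')>u_i(x)$. Then $MTS=\mathcal{M}$, i.e., the myopically team-wise stable states are exactly the maximal states.
   Context: Team formation model. $N$ is a finite set of $n$ agents; $\mathbf{w}\in\mathbb{N}_+^n$ is the vector of time endowments ($\mathbb{N}_+$ = positive integers, $\mathbb{N}$ = non-negative integers). A team is a vector $\mathbf{t}\in\mathbb{N}^n$ with $\mathbf{t}\le\mathbf{w}$ componentwise; $T$ is the set of teams. $A$ is a finite set of activities. A project is a pair $p=(a,\mathbf{t})\in A\times T$; the technology is a given set $P\subseteq A\times T$. For $p=(a,\mathbf{t})$, $n(p)=\{i\in N: t_i>0\}$. A state is a collection of projects $x\subseteq P$ in which every activity is performed by only one team (no two projects in $x$ with different teams have the same activity); $\mathbf{e}(x)=\sum_{(a,\mathbf{t})\in x}\mathbf{t}$; a state $x$ is feasible if $\mathbf{e}(x)\le\mathbf{w}$; $X$ is the set of all feasible states. Each agent $i$ has a utility function $u_i:X\to\mathbb{R}$, and $\mathbf{u}=(u_i)_{i\in N}$. $\mathcal{M}=\{x\in X: x\subseteq x' \text{ and } x\neq x' \Rightarrow x'\notin X\}$ is the set of maximal states. A state $x\in X$ is myopically team-wise stable if (i) for every $p\in x$ and every $i\in n(p)$, $u_i(x)\ge u_i(x\setminus\{p\})$; and (ii) there is no project $p\in P$ such that $x\cup\{p\}\in X$ and $u_i(x\cup\{p\})>u_i(x)$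 for every $i\in n(p)$. $MTS$ is the set of myopically team-wise stable states.
   Formalization: In condition (ii) of myopic team-wise stability the added project p is required not to belong to x already; without this the claim fails whenever P contains a project with the zero team (e.g. P={(a,0)}), and otherwise nothing changes. *)

theory Defs
  imports Complex_Main "HOL-Library.FuncSet"
begin

text \<open>Vectors indexed by the agent set \<open>N\<close> are functions on \<open>N\<close>; teams are made extensional
  (undefined outside \<open>N\<close>), so that equality of teams is equality of vectors over \<open>N\<close>.\<close>

type_synonym 'i team = "'i \<Rightarrow> nat"
type_synonym ('a, 'i) project = "'a \<times> 'i team"

definition teams :: "'i set \<Rightarrow> ('i \<Rightarrow> nat) \<Rightarrow> 'i team set" where
  "teams N w = (\<Pi>\<^sub>E i\<in>N. {t. t \<le> w i})"

definition team_formation_model ::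
  "'i set \<Rightarrow> ('i \<Rightarrow> nat) \<Rightarrow> 'a set \<Rightarrow> ('a, 'i) project set \<Rightarrow> bool" where
  "team_formation_model N w A P \<longleftrightarrow>
     finite N \<and> (\<forall>i\<in>N. w i > 0) \<and> finite A \<and> P \<subseteq> A \<times> teams N w"

definition members :: "'i set \<Rightarrow> ('a, 'i) project \<Rightarrow> 'i set" where
  "members N p = {i \<in> N. snd p i > 0}"

definition is_state :: "('a, 'i) project set \<Rightarrow> ('a, 'i) project set \<Rightarrow> bool" where
  "is_state P x \<longleftrightarrow> x \<subseteq> P \<and> (\<forall>a t t'. (a, t) \<in> x \<and> (a, t') \<in> x \<longrightarrow> t = t')"

definition effort :: "('a, 'i) project set \<Rightarrow> 'i \<Rightarrow> nat" where
  "effort x i = (\<Sum>(a, t)\<in>x. t i)"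

definition feasible_states ::
  "'i set \<Rightarrow> ('i \<Rightarrow> nat) \<Rightarrow> ('a, 'i) project set \<Rightarrow> ('a, 'i) project set set" where
  "feasible_states N w P = {x. is_state P x \<and> (\<forall>i\<in>N. effort x i \<le> w i)}"

definition maximal_states ::
  "'i set \<Rightarrow> ('i \<Rightarrow> nat) \<Rightarrow> ('a, 'i) project set \<Rightarrow> ('a, 'i) project set set" where
  "maximal_states N w P =
     {x \<in> feasible_states N w P. \<forall>x'. x \<subseteq> x' \<and> x \<noteq> x' \<longrightarrow> x' \<notin> feasible_states N w P}"

text \<open>Utilities are only ever evaluated at feasible states: removing a project from a feasible
  state leaves it feasible.

  In the second condition the added project \<open>p\<close> is required to be new. This matters only if
  \<open>p\<close> has the zero team: then \<open>members N p\<close> is empty, and without \<open>p \<notin> x\<close> every feasible state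
  containing \<open>p\<close> would be blocked, vacuously, by \<open>p\<close> itself. For all other projects \<open>p \<notin> x\<close> is
  automatic, see \<open>MTS_literal\<close> below.\<close>

definition MTS ::
  "'i set \<Rightarrow> ('i \<Rightarrow> nat) \<Rightarrow> ('a, 'i) project set \<Rightarrow> ('i \<Rightarrow> ('a, 'i) project set \<Rightarrow> real)
     \<Rightarrow> ('a, 'i) project set set" where
  "MTS N w P u =
     {x \<in> feasible_states N w P.
        (\<forall>p\<in>x. \<forall>i\<in>members N p. u i x \<ge> u i (x - {p})) \<and>
        \<not> (\<exists>p\<in>P. p \<notin> x \<and> x \<union> {p} \<in> feasible_states N w P \<and>
             (\<forall>i\<in>members N p. u i (x \<union> {p}) > u i x))}"

lemma MTS_literal:
  assumes "\<And>p. p \<in> P \<Longrightarrow> members N p \<noteq> {}"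
  shows "MTS N w P u =
     {x \<in> feasible_states N w P.
        (\<forall>p\<in>x. \<forall>i\<in>members N p. u i x \<ge> u i (x - {p})) \<and>
        \<not> (\<exists>p\<in>P. x \<union> {p} \<in> feasible_states N w P \<and>
             (\<forall>i\<in>members N p. u i (x \<union> {p}) > u i x))}"
proof -
  have "p \<notin> x" if "p \<in> P" "\<forall>i\<in>members N p. u i (x \<union> {p}) > u i x" for p x
  proof
    assume "p \<in> x"
    then have "x \<union> {p} = x" by blast
    with that assms[OF that(1)] show False by auto
  qed
  then show ?thesis unfolding MTS_def by blast
qed

end

theory Submission
  imports Defs
begin

text \<open>Efforts are sums of non-negative terms, so feasibility passes to subsets
  (\<open>feasible_states_subset\<close>). As every feasible addition strictly benefits the members
  of the added project, no member gains by dropping a project from a feasible state, and a state is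
  blocked exactly when some new project can be feasibly added. By closure under subsets, this is
  possible exactly when the state has a feasible proper superset.\<close>

lemma finite_projects:
  assumes "team_formation_model N w A P"
  shows "finite P"
proof -
  \<comment> \<open>Extensionality makes a team determined by its finitely many bounded values on
    \<open>N\<close>.\<close>
  have "finite (teams N w)"
    using assms unfolding teams_def team_formation_model_def by (auto intro: finite_PiE)
  then show ?thesis
    using assms unfolding team_formation_model_def by (meson finite_SigmaI finite_subset)
qed

text \<open>Finiteness is essential: \<^const>\<open>effort\<close> of an infinite set is the junk value \<open>0\<close>.\<close>

lemma feasible_states_subset:
  assumes "finite P" "x \<in> feasible_states N w P" "y \<subseteq> x"
  shows "y \<in> feasible_states N w P"
proof -
  have x: "is_state P x" "\<forall>i\<in>N. effort x i \<le> w i"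
    using assms(2) by (auto simp: feasible_states_def)
  have "finite x"
    using x(1) assms(1) by (auto simp: is_state_def intro: finite_subset)
  then have "effort y i \<le> effort x i" for i
    unfolding effort_def using assms(3) by (intro sum_mono2) auto
  then have "\<forall>i\<in>N. effort y i \<le> w i"
    using x(2) order_trans by blast
  moreover have "is_state P y"
    using x(1) assms(3) unfolding is_state_def by blast
  ultimately show ?thesis by (simp add: feasible_states_def)
qed

theorem lemma1:
  fixes N :: "'i set" and w :: "'i \<Rightarrow> nat" and A :: "'a set"
    and P :: "('a, 'i) project set"
    and u :: "'i \<Rightarrow> ('a, 'i) project set \<Rightarrow> real"
  assumes "team_formation_model N w A P"
    and "\<And>x x' p i. \<lbrakk>x \<in> feasible_states N w P; x' \<in> feasible_states N w P; x' \<noteq> x;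
           p \<in> P; x' = x \<union> {p}; i \<in> members N p\<rbrakk> \<Longrightarrow> u i x' > u i x"
  shows "MTS N w P u = maximal_states N w P"
proof (intro equalityI subsetI)
  note sub = feasible_states_subset[OF finite_projects[OF assms(1)]]
  have in_P: "x \<subseteq> P" if "x \<in> feasible_states N w P" for x
    using that by (simp add: feasible_states_def is_state_def)
  {
    fix x assume x: "x \<in> MTS N w P u"
    then have feas: "x \<in> feasible_states N w P" by (simp add: MTS_def)
    have "x' \<notin> feasible_states N w P" if less: "x \<subseteq> x'" "x \<noteq> x'" for x'
    proof
      assume x': "x' \<in> feasible_states N w P"
      \<comment> \<open>Maximality concerns arbitrary supersets, stability single additions;
        \<open>x \<union> {p}\<close> lies between \<open>x\<close> and \<open>x'\<close>, so it
        inherits feasibility from \<open>x'\<close>.\<close>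
      obtain p where p: "p \<in> x'" "p \<notin> x" using less by blast
      have pP: "p \<in> P" using in_P[OF x'] p(1) by blast
      have xp: "x \<union> {p} \<in> feasible_states N w P"
        by (rule sub[OF x']) (use less p in blast)
      have "\<forall>i\<in>members N p. u i (x \<union> {p}) > u i x"
        using assms(2)[OF feas xp _ pP refl] p(2) by blast
      with x pP p(2) xp show False unfolding MTS_def by blast
    qed
    with feas show "x \<in> maximal_states N w P" by (simp add: maximal_states_def)
  next
    fix x assume x: "x \<in> maximal_states N w P"
    then have feas: "x \<in> feasible_states N w P" by (simp add: maximal_states_def)
    have "u i x \<ge> u i (x - {p})" if p: "p \<in> x" and i: "i \<in> members N p" for p i
    proof -
      \<comment> \<open>Read backwards, dropping \<open>p\<close> is an addition: the monotonicity
        assumption applies to the step from \<open>x - {p}\<close> to \<open>x\<close>.\<close>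
      have "x - {p} \<in> feasible_states N w P" by (rule sub[OF feas]) blast
      then have "u i x > u i (x - {p})"
        by (rule assms(2)[OF _ feas _ _ _ i]) (use p in_P[OF feas] in auto)
      then show ?thesis by simp
    qed
    \<comment> \<open>Here \<open>p \<notin> x\<close> matters: it makes
      \<open>x \<union> {p}\<close> a proper superset, which maximality rules out.\<close>
    moreover have "x \<union> {p} \<notin> feasible_states N w P" if "p \<notin> x" for p
      using x that unfolding maximal_states_def by blast
    ultimately show "x \<in> MTS N w P u"
      using feas unfolding MTS_def by blast
  }
qed

end
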